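(* $\mathcal{L}^*$ is strictly more expressive than $\mathcal{L}_{[S,\chi]}$, i.e., $\mathcal{L}_{[S,\chi]}\preccurlyeq\mathcal{L}^*$ and $\mathcal{L}^*\not\preccurlyeq\mathcal{L}_{[S,\chi]}$.
   Context: Fix a finite non-empty set of agents $A$ and a non-empty countable set of atoms $\mathtt{P}$. A model is $M=\langle W,R,V\rangle$ with $W$ non-empty, $R=\{R_i\subseteq W\times W\mid i\in A\}$ arbitrary relations, $V:\mathtt{P}\to\mathcal{P}(W)$; $R_G:=\bigcap_{k\in G}R_k$ (with $R_\emptyset:=W\times W$). $\mathcal{L}_D$: $\varphi::=p\mid\lnot\varphi\mid\varphi\land\varphi\mid D_G\varphi$ ($\emptyset\neq G\subseteq A$), with $(M,w)\Vdash D_G\varphi$ iff $\varphi$ holds at all $u$ with $(w,u)\in R_G$. $\|\chi\|^M$ is the truth set of $\chi$, $\sim^M_\chi:=(\|\chi\|^M\times\|\chi\|^M)\cup(\|\lnot\chi\|^M\times\|\lnot\chi\|^M)$, and for $S\subseteq A$, $M^{S,\chi}=\langle W,R^{S,\chi},V\rangle$ with $R^{S,\chi}_i:=R_i\cap(R_S\cup\sim^M_\chi)$. $\mathcal{L}_{[S,\chi]}$ is $\bigcup_n\mathcal{L}^n$ with $\mathcal{L}^0=\mathcal{L}_D$ and $\mathcal{L}^{n+1}$ extending $\mathcal{L}^n$ with $[S,\chi]\varphi$ for $S\subseteq A$, $\chi\in\mathcal{L}^n$; $(M,w)\Vdash[S,\chi]\varphi$ iff $(M^{S,\chi},w)\Vdash\varphi$.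 $\mathcal{L}^*$ is $\bigcup_n\mathcal{L}^{*,n}$, where $\mathcal{L}^{*,0}$ is $\mathcal{L}_D$ extended with $[S]\varphi$ ($S\subseteq A$), and $\mathcal{L}^{*,n+1}$ extends $\mathcal{L}^{*,n}$ with $[S,\chi]\varphi$ for $\chi\in\mathcal{L}^{*,n}$; $(M,w)\Vdash[S]\varphi$ iff $(M^{S,\chi},w)\Vdash\varphi$ for every $\chi\in\mathcal{L}_D$. For languages $\mathcal{L}_1,\mathcal{L}_2$ interpreted over pointed models, $\mathcal{L}_1\preccurlyeq\mathcal{L}_2$ iff every $\alpha_1\in\mathcal{L}_1$ has some $\alpha_2\in\mathcal{L}_2$ with the same truth value in every pointed model.
   Formalization: Non-reducibility of L* to L_[S,χ] is stated only for at least two agents (with one agent every update leaves the model unchanged, so the claim fails); the comparison ranges over pointed models whose worlds lie in an arbitrary fixed infinite set. *)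

theory Defs
  imports Main "HOL-Library.Countable" "HOL-Library.Cardinality"
begin

text \<open>
  The agents are the elements of a type \<open>'a\<close> of class \<^class>\<open>finite\<close>, the atoms those of a type
  \<open>'p\<close> of class \<^class>\<open>countable\<close>; both are non-empty because all types are.
\<close>

record ('w, 'a, 'p) model =
  worlds :: "'w set"
  rel :: "'a \<Rightarrow> ('w \<times> 'w) set"
  val :: "'p \<Rightarrow> 'w set"

definition is_model :: "('w, 'a, 'p) model \<Rightarrow> bool" where
  "is_model M \<longleftrightarrow>
     worlds M \<noteq> {} \<and> (\<forall>i. rel M i \<subseteq> worlds M \<times> worlds M) \<and> (\<forall>p. val M p \<subseteq> worlds M)"

definition rel_group :: "('w, 'a, 'p) model \<Rightarrow> 'a set \<Rightarrow> ('w \<times> 'w) set" where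
  "rel_group M G = (worlds M \<times> worlds M) \<inter> (\<Inter>k\<in>G. rel M k)"

text \<open>
  In the next two definitions \<open>X\<close> is the truth set of the formula \<open>\<chi>\<close>, so that
  \<^term>\<open>worlds M - X\<close> is the truth set of its negation (see \<open>truth_set_Neg\<close> below).
\<close>

definition same_truth :: "('w, 'a, 'p) model \<Rightarrow> 'w set \<Rightarrow> ('w \<times> 'w) set" where
  "same_truth M X = X \<times> X \<union> (worlds M - X) \<times> (worlds M - X)"

definition update :: "('w, 'a, 'p) model \<Rightarrow> 'a set \<Rightarrow> 'w set \<Rightarrow> ('w, 'a, 'p) model" where
  "update M S X = M\<lparr>rel := \<lambda>i. rel M i \<inter> (rel_group M S \<union> same_truth M X)\<rparr>"

text \<open>
  \<open>Upd S \<chi> \<phi>\<close> is $[S,\chi]\varphi$ and \<open>Arb S \<phi>\<close> is $[S]\varphi$. The datatype contains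
  raw formulas only; the languages are carved out of it by \<open>lang\<close>.
\<close>

datatype ('a, 'p) fm =
    Atom 'p
  | Neg "('a, 'p) fm"
  | Conj "('a, 'p) fm" "('a, 'p) fm"
  | Dist "'a set" "('a, 'p) fm"
  | Upd "'a set" "('a, 'p) fm" "('a, 'p) fm"
  | Arb "'a set" "('a, 'p) fm"

text \<open>
  \<open>lang b X\<close> is the language of distributed knowledge extended with \<open>Upd S \<chi> \<phi>\<close> for
  \<open>\<chi> \<in> X\<close> and, if \<open>b\<close> holds, with \<open>Arb S \<phi>\<close>.
\<close>

inductive_set lang :: "bool \<Rightarrow> ('a, 'p) fm set \<Rightarrow> ('a, 'p) fm set"
  for b :: bool and X :: "('a, 'p) fm set" where
  Atom: "Atom p \<in> lang b X"
| Neg: "\<phi> \<in> lang b X \<Longrightarrow> Neg \<phi> \<in> lang b X"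
| Conj: "\<phi> \<in> lang b X \<Longrightarrow> \<psi> \<in> lang b X \<Longrightarrow> Conj \<phi> \<psi> \<in> lang b X"
| Dist: "G \<noteq> {} \<Longrightarrow> \<phi> \<in> lang b X \<Longrightarrow> Dist G \<phi> \<in> lang b X"
| Upd: "\<chi> \<in> X \<Longrightarrow> \<phi> \<in> lang b X \<Longrightarrow> Upd S \<chi> \<phi> \<in> lang b X"
| Arb: "b \<Longrightarrow> \<phi> \<in> lang b X \<Longrightarrow> Arb S \<phi> \<in> lang b X"

definition L_D :: "('a, 'p) fm set" where
  "L_D = lang False {}"

primrec L_upd_level :: "nat \<Rightarrow> ('a, 'p) fm set" where
  "L_upd_level 0 = L_D"
| "L_upd_level (Suc n) = lang False (L_upd_level n)"

definition L_upd :: "('a, 'p) fm set" where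
  "L_upd = (\<Union>n. L_upd_level n)"

primrec L_star_level :: "nat \<Rightarrow> ('a, 'p) fm set" where
  "L_star_level 0 = lang True {}"
| "L_star_level (Suc n) = lang True (L_star_level n)"

definition L_star :: "('a, 'p) fm set" where
  "L_star = (\<Union>n. L_star_level n)"

primrec arb_count :: "('a, 'p) fm \<Rightarrow> nat" where
  "arb_count (Atom p) = 0"
| "arb_count (Neg \<phi>) = arb_count \<phi>"
| "arb_count (Conj \<phi> \<psi>) = arb_count \<phi> + arb_count \<psi>"
| "arb_count (Dist G \<phi>) = arb_count \<phi>"
| "arb_count (Upd S \<chi> \<phi>) = arb_count \<chi> + arb_count \<phi>"
| "arb_count (Arb S \<phi>) = Suc (arb_count \<phi>)"

lemma arb_count_L_D: "\<chi> \<in> L_D \<Longrightarrow> arb_count \<chi> = 0"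
  unfolding L_D_def by (induction rule: lang.induct) auto

function sat :: "('w, 'a, 'p) model \<Rightarrow> 'w \<Rightarrow> ('a, 'p) fm \<Rightarrow> bool" where
  "sat M w (Atom p) \<longleftrightarrow> w \<in> val M p"
| "sat M w (Neg \<phi>) \<longleftrightarrow> \<not> sat M w \<phi>"
| "sat M w (Conj \<phi> \<psi>) \<longleftrightarrow> sat M w \<phi> \<and> sat M w \<psi>"
| "sat M w (Dist G \<phi>) \<longleftrightarrow> (\<forall>u. (w, u) \<in> rel_group M G \<longrightarrow> sat M u \<phi>)"
| "sat M w (Upd S \<chi> \<phi>) \<longleftrightarrow> sat (update M S {u \<in> worlds M. sat M u \<chi>}) w \<phi>"
| "sat M w (Arb S \<phi>) \<longleftrightarrow> (\<forall>\<chi>\<in>L_D. sat (update M S {u \<in> worlds M. sat M u \<chi>}) w \<phi>)"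
  by pat_completeness auto
termination
  by (relation "inv_image (less_than <*lex*> less_than) (\<lambda>(M, w, \<phi>). (arb_count \<phi>, size \<phi>))")
    (auto simp: arb_count_L_D)

definition truth_set :: "('w, 'a, 'p) model \<Rightarrow> ('a, 'p) fm \<Rightarrow> 'w set" where
  "truth_set M \<chi> = {u \<in> worlds M. sat M u \<chi>}"

lemma truth_set_Neg: "truth_set M (Neg \<chi>) = worlds M - truth_set M \<chi>"
  by (auto simp: truth_set_def)

text \<open>
  HOL cannot quantify over types, so the comparison is made for the pointed models whose worlds
  are drawn from a type \<open>'w\<close>.
\<close>

definition at_most_as_expressive ::
    "'w itself \<Rightarrow> ('a, 'p) fm set \<Rightarrow> ('a, 'p) fm set \<Rightarrow> bool" where
  "at_most_as_expressive _ L1 L2 \<longleftrightarrow>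
     (\<forall>\<alpha>1\<in>L1. \<exists>\<alpha>2\<in>L2. \<forall>(M :: ('w, 'a, 'p) model) w.
        is_model M \<longrightarrow> w \<in> worlds M \<longrightarrow> (sat M w \<alpha>1 \<longleftrightarrow> sat M w \<alpha>2))"

text \<open>
  With a single agent every update leaves the model unchanged, so that \<^term>\<open>L_star\<close> is not
  strictly more expressive than \<^term>\<open>L_upd\<close>; strictness needs two agents.
\<close>

lemma update_one_agent:
  fixes M :: "('w, 'a::finite, 'p) model"
  assumes "CARD('a) = 1" and M: "is_model M"
  shows "update M S X = M"
proof -
  obtain a :: 'a where a: "UNIV = {a}"
    using assms(1) by (auto simp: card_1_singleton_iff)
  have eq: "i = a" for i :: 'a using a by auto
  have "rel M i \<subseteq> rel_group M S" for i
  proof -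
    have "rel M i \<subseteq> rel M k" for k using eq[of i] eq[of k] by simp
    then show ?thesis using M unfolding is_model_def rel_group_def by blast
  qed
  then have "(\<lambda>i. rel M i \<inter> (rel_group M S \<union> same_truth M X)) = rel M"
    by (intro ext) blast
  then show ?thesis by (simp add: update_def)
qed

primrec erase :: "('a, 'p) fm \<Rightarrow> ('a, 'p) fm" where
  "erase (Atom p) = Atom p"
| "erase (Neg \<phi>) = Neg (erase \<phi>)"
| "erase (Conj \<phi> \<psi>) = Conj (erase \<phi>) (erase \<psi>)"
| "erase (Dist G \<phi>) = Dist G (erase \<phi>)"
| "erase (Upd S \<chi> \<phi>) = erase \<phi>"
| "erase (Arb S \<phi>) = erase \<phi>"

lemma one_agent_not_strict:
  assumes "CARD('a::finite) = 1"
  shows "at_most_as_expressive TYPE('w) (L_star :: ('a, 'p) fm set) L_upd"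
proof -
  have ne: "\<exists>\<chi> :: ('a, 'p) fm. \<chi> \<in> L_D"
    unfolding L_D_def by (rule exI[of _ "Atom undefined"]) (rule lang.Atom)
  have sat: "sat M w \<phi> \<longleftrightarrow> sat M w (erase \<phi>)"
    if "is_model M" for M :: "('w, 'a, 'p) model" and w and \<phi> :: "('a, 'p) fm"
    using ne by (induction \<phi> arbitrary: w) (auto simp: update_one_agent[OF assms that])
  have "erase \<phi> \<in> L_D" if "\<phi> \<in> lang b X" for b X and \<phi> :: "('a, 'p) fm"
    using that unfolding L_D_def by (induction rule: lang.induct) (auto intro: lang.intros)
  then have "erase \<phi> \<in> L_D" if "\<phi> \<in> L_star_level n" for n and \<phi> :: "('a, 'p) fm"
    using that by (cases n) auto
  then have "erase \<phi> \<in> L_upd" if "\<phi> \<in> L_star" for \<phi> :: "('a, 'p) fm"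
    using that unfolding L_star_def L_upd_def by (metis UN_iff UNIV_I L_upd_level.simps(1))
  with sat show ?thesis
    unfolding at_most_as_expressive_def by blast
qed

end

theory Submission
  imports Defs
begin

text \<open>
  The formula $[\{a\}]\lnot D_{\{b\}}\bot$ says that no formula of $\mathcal{L}_D$ separates the
  current world from all its \<open>b\<close>-successors that are not also \<open>a\<close>-successors. It holds at a single
  \<open>b\<close>-reflexive world. It fails at the root of a finite \<open>b\<close>-chain, since the root and its
  successor differ in their distance to the dead end. A formula without arbitrary updates only sees
  a bounded initial segment of such a chain, even through its updates: the formula of an update is
  constant on a long initial segment by induction, so no edge is cut there. Hence on long chains its
  value at the root is its value at the reflexive world.
\<close>

lemma lang_mono: "\<phi> \<in> lang b X \<Longrightarrow> (b \<longrightarrow> c) \<Longrightarrow> X \<subseteq> Y \<Longrightarrow> \<phi> \<in> lang c Y"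
  by (induction rule: lang.induct) (auto intro: lang.intros)

lemma L_upd_level_subset_L_star_level: "L_upd_level n \<subseteq> L_star_level n"
proof (induction n)
  case 0
  then show ?case by (auto simp: L_D_def intro: lang_mono)
next
  case (Suc n)
  then show ?case by (auto intro: lang_mono)
qed

lemma L_upd_subset_L_star: "L_upd \<subseteq> L_star"
  using L_upd_level_subset_L_star_level unfolding L_upd_def L_star_def by blast

definition loop_model :: "'a \<Rightarrow> 'w \<Rightarrow> ('w, 'a, 'p) model" where
  "loop_model b x = \<lparr>worlds = {x}, rel = \<lambda>i. if i = b then {(x, x)} else {}, val = \<lambda>p. {}\<rparr>"

definition chain_model :: "'a \<Rightarrow> (nat \<Rightarrow> 'w) \<Rightarrow> nat \<Rightarrow> ('w, 'a, 'p) model" where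
  "chain_model b f n =
     \<lparr>worlds = f ` {..n}, rel = \<lambda>i. if i = b then {(f j, f (Suc j)) | j. j < n} else {},
      val = \<lambda>p. {}\<rparr>"

text \<open>Nothing is said about edges out of \<open>f n\<close> or about other worlds, so the
  property, with a smaller bound, survives an update that cuts edges further along.\<close>

definition starts_with_chain :: "'a \<Rightarrow> (nat \<Rightarrow> 'w) \<Rightarrow> nat \<Rightarrow> ('w, 'a, 'p) model \<Rightarrow> bool" where
  "starts_with_chain b f n N \<longleftrightarrow>
     (\<forall>j\<le>n. f j \<in> worlds N \<and> (\<forall>p. f j \<notin> val N p)) \<and>
     (\<forall>j<n. \<forall>i u. (f j, u) \<in> rel N i \<longleftrightarrow> i = b \<and> u = f (Suc j))"

lemma is_model_loop_model: "is_model (loop_model b x)"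
  by (auto simp: is_model_def loop_model_def)

lemma is_model_chain_model: "is_model (chain_model b f n)"
  by (auto simp: is_model_def chain_model_def)

lemma starts_with_chain_chain_model:
  "inj f \<Longrightarrow> starts_with_chain b f n (chain_model b f n)"
  by (auto simp: starts_with_chain_def chain_model_def inj_eq)

text \<open>A world agrees with itself on every \<open>X\<close>, so a reflexive edge is never
  cut.\<close>

lemma update_loop_model: "update (loop_model b x) S X = loop_model b x"
  by (auto simp: update_def loop_model_def same_truth_def rel_group_def fun_eq_iff)

lemma rel_group_loop_model:
  "G \<noteq> {} \<Longrightarrow> (x, u) \<in> rel_group (loop_model b x) G \<longleftrightarrow> G = {b} \<and> u = x"
  by (auto simp: rel_group_def loop_model_def split: if_splits)

lemma rel_group_starts_with_chain:
  assumes "starts_with_chain b f n N" "G \<noteq> {}" "j < n"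
  shows "(f j, u) \<in> rel_group N G \<longleftrightarrow> G = {b} \<and> u = f (Suc j)"
  using assms by (auto simp: rel_group_def starts_with_chain_def)

text \<open>An edge is cut only if its endpoints disagree about \<open>X\<close>; constancy up to
  \<open>m\<close> protects all edges before \<open>f m\<close>.\<close>

lemma starts_with_chain_update:
  assumes N: "starts_with_chain b f n N" and "m \<le> n"
    and const: "\<And>j. j \<le> m \<Longrightarrow> f j \<in> X \<longleftrightarrow> c"
  shows "starts_with_chain b f m (update N S X)"
proof -
  have "(f j, f (Suc j)) \<in> same_truth N X" if "j < m" for j
    using that const[of j] const[of "Suc j"] N \<open>m \<le> n\<close>
    by (auto simp: same_truth_def starts_with_chain_def)
  then show ?thesis
    using N \<open>m \<le> n\<close> by (auto simp: starts_with_chain_def update_def)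
qed

text \<open>The loop stands in for an infinite chain, and \<open>k\<close> is the length of chain
  ahead that makes the two indistinguishable. Quantifying over all \<open>N\<close> covers the
  models that arise from updates.\<close>

definition sees_up_to :: "'a \<Rightarrow> (nat \<Rightarrow> 'w) \<Rightarrow> nat \<Rightarrow> ('a, 'p) fm \<Rightarrow> bool" where
  "sees_up_to b f k \<phi> \<longleftrightarrow>
     (\<forall>(N :: ('w, 'a, 'p) model) n j. starts_with_chain b f n N \<longrightarrow> j + k \<le> n \<longrightarrow>
        (sat N (f j) \<phi> \<longleftrightarrow> sat (loop_model b (f 0) :: ('w, 'a, 'p) model) (f 0) \<phi>))"

text \<open>The costs add up: \<chi> is constant on all but the last \<open>k\<close> worlds of the
  segment, so the update keeps a chain shorter by \<open>k\<close>, on which \<phi> still has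
  \<open>l\<close> steps ahead.\<close>

lemma sees_up_to_Upd:
  fixes f :: "nat \<Rightarrow> 'w" and \<chi> \<phi> :: "('a, 'p) fm"
  assumes \<chi>: "sees_up_to b f k \<chi>" and \<phi>: "sees_up_to b f l \<phi>"
  shows "sees_up_to b f (k + l) (Upd S \<chi> \<phi>)"
  unfolding sees_up_to_def
proof (intro allI impI)
  fix N :: "('w, 'a, 'p) model" and n j
  assume N: "starts_with_chain b f n N" and le: "j + (k + l) \<le> n"
  define X where "X = {u \<in> worlds N. sat N u \<chi>}"
  have "f i \<in> X \<longleftrightarrow> sat (loop_model b (f 0) :: ('w, 'a, 'p) model) (f 0) \<chi>"
    if "i \<le> n - k" for i
  proof -
    \<comment> \<open>\<open>le\<close> yields \<open>k \<le> n\<close>, so the subtraction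
      \<open>n - k\<close> is not truncated.\<close>
    have "i + k \<le> n" using that le by simp
    moreover have "f i \<in> worlds N" using N that by (auto simp: starts_with_chain_def)
    ultimately show ?thesis using \<chi> N unfolding sees_up_to_def X_def by blast
  qed
  then have "starts_with_chain b f (n - k) (update N S X)"
    by (intro starts_with_chain_update[OF N]) auto
  moreover have "j + l \<le> n - k" using le by simp
  ultimately show "sat N (f j) (Upd S \<chi> \<phi>) \<longleftrightarrow>
      sat (loop_model b (f 0) :: ('w, 'a, 'p) model) (f 0) (Upd S \<chi> \<phi>)"
    using \<phi> unfolding sees_up_to_def by (simp add: update_loop_model X_def)
qed

text \<open>Structural induction within one level; the assumption on \<open>X\<close> carries the
  result for the update formulas, which come from the level below.\<close>

lemma lang_sees_up_to:
  fixes f :: "nat \<Rightarrow> 'w" and \<phi> :: "('a, 'p) fm"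
  assumes "\<phi> \<in> lang False X" and "\<And>\<chi>. \<chi> \<in> X \<Longrightarrow> \<exists>k. sees_up_to b f k \<chi>"
  shows "\<exists>k. sees_up_to b f k \<phi>"
  using assms(1)
proof (induction rule: lang.induct)
  case (Atom p)
  have "sees_up_to b f 0 (Atom p)"
    by (auto simp: sees_up_to_def starts_with_chain_def loop_model_def)
  then show ?case ..
next
  case (Neg \<phi>)
  then show ?case by (simp add: sees_up_to_def)
next
  case (Conj \<phi> \<psi>)
  then obtain k l where kl: "sees_up_to b f k \<phi>" "sees_up_to b f l \<psi>" by blast
  then have "sees_up_to b f (k + l) (Conj \<phi> \<psi>)"
    unfolding sees_up_to_def
  proof (intro allI impI)
    fix N :: "('w, 'a, 'p) model" and n j
    assume N: "starts_with_chain b f n N" and le: "j + (k + l) \<le> n"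
    let ?L = "loop_model b (f 0) :: ('w, 'a, 'p) model"
    have "j + k \<le> n" "j + l \<le> n" using le by auto
    with kl N have "sat N (f j) \<phi> \<longleftrightarrow> sat ?L (f 0) \<phi>" "sat N (f j) \<psi> \<longleftrightarrow> sat ?L (f 0) \<psi>"
      unfolding sees_up_to_def by blast+
    then show "sat N (f j) (Conj \<phi> \<psi>) \<longleftrightarrow> sat ?L (f 0) (Conj \<phi> \<psi>)" by simp
  qed
  then show ?case ..
next
  case (Dist G \<phi>)
  then obtain k where k: "sees_up_to b f k \<phi>" by blast
  have "sees_up_to b f (Suc k) (Dist G \<phi>)"
    unfolding sees_up_to_def
  proof (intro allI impI)
    fix N :: "('w, 'a, 'p) model" and n j
    assume N: "starts_with_chain b f n N" and le: "j + Suc k \<le> n"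
    then have "j < n" "Suc j + k \<le> n" by auto
    moreover from this have "sat N (f (Suc j)) \<phi> \<longleftrightarrow>
        sat (loop_model b (f 0) :: ('w, 'a, 'p) model) (f 0) \<phi>"
      using k N unfolding sees_up_to_def by blast
    \<comment> \<open>For \<open>G\<close> other than \<open>{b}\<close>, neither world has a
      \<open>G\<close>-successor and both sides hold vacuously.\<close>
    ultimately show "sat N (f j) (Dist G \<phi>) \<longleftrightarrow>
        sat (loop_model b (f 0) :: ('w, 'a, 'p) model) (f 0) (Dist G \<phi>)"
      using \<open>G \<noteq> {}\<close> by (simp add: rel_group_starts_with_chain[OF N] rel_group_loop_model)
  qed
  then show ?case ..
next
  case (Upd \<chi> \<phi> S)
  obtain k l where "sees_up_to b f k \<chi>" "sees_up_to b f l \<phi>"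
    using assms(2)[OF \<open>\<chi> \<in> X\<close>] Upd.IH by blast
  then have "sees_up_to b f (k + l) (Upd S \<chi> \<phi>)" by (rule sees_up_to_Upd)
  then show ?case ..
next
  case (Arb \<phi> S)
  then show ?case by simp
qed

lemma L_upd_sees_up_to:
  fixes f :: "nat \<Rightarrow> 'w" and \<phi> :: "('a, 'p) fm"
  assumes "\<phi> \<in> L_upd"
  shows "\<exists>k. sees_up_to b f k \<phi>"
proof -
  have "\<exists>k. sees_up_to b f k \<psi>" if "\<psi> \<in> L_upd_level n" for n and \<psi> :: "('a, 'p) fm"
    using that
  proof (induction n arbitrary: \<psi>)
    case 0
    then show ?case using lang_sees_up_to[of \<psi> "{}"] by (simp add: L_D_def)
  next
    case (Suc n)
    then show ?case using lang_sees_up_to[of \<psi> "L_upd_level n" b f] by simp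
  qed
  then show ?thesis using assms by (auto simp: L_upd_def)
qed

definition falsum :: "('a, 'p) fm" where
  "falsum = Conj (Atom undefined) (Neg (Atom undefined))"

lemma sat_falsum [simp]: "\<not> sat M w falsum"
  by (simp add: falsum_def)

lemma falsum_in_lang: "falsum \<in> lang b X"
  by (simp add: falsum_def lang.intros)

lemma iterated_box_in_L_D: "(Dist {b} ^^ m) falsum \<in> L_D"
  unfolding L_D_def by (induction m) (auto intro: falsum_in_lang lang.Dist)

text \<open>The formula says that no path of \<open>m\<close> steps along \<open>b\<close> starts
  here, and from \<open>f j\<close> exactly \<open>n - j\<close> steps are possible.\<close>

lemma sat_chain_model_iterated_box:
  fixes f :: "nat \<Rightarrow> 'w"
  assumes "inj f" "j \<le> n"
  shows "sat (chain_model b f n :: ('w, 'a, 'p) model) (f j) ((Dist {b} ^^ m) falsum) \<longleftrightarrow> n < j + m"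
  using assms(2)
proof (induction m arbitrary: j)
  case 0
  then show ?case by simp
next
  case (Suc m)
  have "(f j, u) \<in> rel_group (chain_model b f n :: ('w, 'a, 'p) model) {b} \<longleftrightarrow> j < n \<and> u = f (Suc j)" for u
    using inj_eq[OF assms(1)] by (auto simp: rel_group_def chain_model_def)
  then show ?case using Suc by auto
qed

lemma sat_loop_model_Arb:
  "sat (loop_model b x) x (Arb {a} (Neg (Dist {b} falsum)))"
  by (simp add: update_loop_model rel_group_loop_model)

text \<open>One update turns the root into a dead end. Edges shared with \<open>a\<close> would be
  immune to it, but as \<open>a \<noteq> b\<close> there are none.\<close>

lemma not_sat_chain_model_Arb:
  fixes f :: "nat \<Rightarrow> 'w"
  assumes "inj f" "a \<noteq> b" "0 < n"
  shows "\<not> sat (chain_model b f n :: ('w, 'a, 'p) model) (f 0) (Arb {a} (Neg (Dist {b} falsum)))"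
proof -
  let ?M = "chain_model b f n :: ('w, 'a, 'p) model"
  \<comment> \<open>With exactly \<open>n\<close> boxes the formula fails at the root, which has
    \<open>n\<close> steps ahead, and holds at its successor, which has
    \<open>n - 1\<close>.\<close>
  let ?\<chi> = "(Dist {b} ^^ n) falsum :: ('a, 'p) fm"
  define X where "X = {u \<in> worlds ?M. sat ?M u ?\<chi>}"
  have "f 0 \<notin> X" "f (Suc 0) \<in> X"
    using assms sat_chain_model_iterated_box[OF assms(1), of 0 n b n]
      sat_chain_model_iterated_box[OF assms(1), of "Suc 0" n b n]
    by (auto simp: X_def chain_model_def)
  then have "(f 0, u) \<notin> rel_group (update ?M {a} X) {b}" for u
    using inj_eq[OF assms(1)] assms(2)
    by (auto simp: rel_group_def update_def same_truth_def chain_model_def)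
  then have "sat (update ?M {a} X) (f 0) (Dist {b} falsum)" by simp
  then show ?thesis using iterated_box_in_L_D[of n b] by (auto simp: X_def)
qed

theorem theorem4p5:
  assumes "infinite (UNIV :: 'w set)"
  shows "at_most_as_expressive TYPE('w) (L_upd :: ('a::finite, 'p::countable) fm set) L_star \<and>
    (2 \<le> CARD('a) \<longrightarrow>
      \<not> at_most_as_expressive TYPE('w) (L_star :: ('a, 'p) fm set) L_upd)"
proof (intro conjI impI notI)
  show "at_most_as_expressive TYPE('w) (L_upd :: ('a, 'p) fm set) L_star"
    using L_upd_subset_L_star unfolding at_most_as_expressive_def by blast
next
  assume "2 \<le> CARD('a)" and expr: "at_most_as_expressive TYPE('w) (L_star :: ('a, 'p) fm set) L_upd"
  then obtain a b :: 'a where "a \<noteq> b"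
    using card_le_Suc0_iff_eq[of "UNIV :: 'a set"] by fastforce
  \<comment> \<open>Infinitely many worlds are available, so one \<open>f\<close> carries chains of
    every length.\<close>
  obtain f :: "nat \<Rightarrow> 'w" where f: "inj f"
    using assms infinite_countable_subset by blast
  let ?\<alpha> = "Arb {a} (Neg (Dist {b} falsum)) :: ('a, 'p) fm"
  have "?\<alpha> \<in> L_star_level 0" by (auto intro!: lang.intros falsum_in_lang)
  then have "?\<alpha> \<in> L_star" unfolding L_star_def by blast
  then obtain \<beta> where "\<beta> \<in> L_upd" and
    \<beta>: "\<And>(M :: ('w, 'a, 'p) model) w. is_model M \<Longrightarrow> w \<in> worlds M \<Longrightarrow> sat M w ?\<alpha> \<longleftrightarrow> sat M w \<beta>"
    using expr unfolding at_most_as_expressive_def by blast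
  obtain k where k: "sees_up_to b f k \<beta>" using L_upd_sees_up_to[OF \<open>\<beta> \<in> L_upd\<close>] by blast
  \<comment> \<open>Length \<open>k\<close> suffices for agreement with the loop; the successor
    ensures that the root has an edge to cut even if \<open>k\<close> is 0.\<close>
  let ?M = "chain_model b f (Suc k) :: ('w, 'a, 'p) model"
  let ?N = "loop_model b (f 0) :: ('w, 'a, 'p) model"
  have "starts_with_chain b f (Suc k) ?M" "0 + k \<le> Suc k"
    using starts_with_chain_chain_model[OF f] by auto
  with k have "sat ?M (f 0) \<beta> \<longleftrightarrow> sat ?N (f 0) \<beta>"
    unfolding sees_up_to_def by blast
  moreover have "f 0 \<in> worlds ?M" "f 0 \<in> worlds ?N"
    by (auto simp: chain_model_def loop_model_def)
  ultimately have "sat ?M (f 0) ?\<alpha> \<longleftrightarrow> sat ?N (f 0) ?\<alpha>"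
    using \<beta>[OF is_model_chain_model] \<beta>[OF is_model_loop_model] by blast
  then show False
    using sat_loop_model_Arb[of b "f 0" a]
      not_sat_chain_model_Arb[OF f \<open>a \<noteq> b\<close> zero_less_Suc[of k]] by blast
qed

end
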